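(* Let $r\in[-R_{\max},R_{\max}]^3$ with $r(1)>r(2)>r(3)$, and let $X\in\mathbb{R}^{3\times d}$ with $d\le 3$ have rows $x_1,x_2,x_3\in\mathbb{R}^d$. Assume that: (a) there exists $w\in\mathbb{R}^d$ such that $r'=Xw$ satisfies, for all $i,j$, $r'(i)>r'(j)$ if and only if $r(i)>r(j)$; (b) $\langle x_2-x_3,\,x_1-x_3\rangle>0$. Let $0<\eta<\frac{4}{9\,R_{\max}\,\lambda_{\max}(X^\top X)}$, let $\theta_1\in\mathbb{R}^d$ be arbitrary, and for $t\ge1$ let $\theta_{t+1}=\theta_t+\eta\,X^\top(\mathrm{diag}(\pi_{\theta_t})-\pi_{\theta_t}\pi_{\theta_t}^\top)\,r$. Then the policies converge to the optimal policy: $\lim_{t\to\infty}\pi_{\theta_t}(1)=1$.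
   Context: $R_{\max}>0$. For $\theta\in\mathbb{R}^d$, $\pi_\theta=\mathrm{softmax}(X\theta)$, i.e. $\pi_\theta(a)=\exp(\langle x_a,\theta\rangle)/\sum_{a'}\exp(\langle x_{a'},\theta\rangle)$. $\lambda_{\max}(M)$ denotes the largest eigenvalue of $M$. The ordering $r(1)>r(2)>r(3)$ is the paper's labeling convention under its assumption that mean rewards are pairwise distinct. *)

theory Defs
  imports "HOL-Analysis.Analysis"
begin

definition softmax :: "real ^ 'k::finite \<Rightarrow> real ^ 'k" where
  "softmax z = (\<chi> a. exp (z $ a) / (\<Sum>b\<in>UNIV. exp (z $ b)))"

definition diag_matrix :: "real ^ 'k::finite \<Rightarrow> real ^ 'k ^ 'k" where
  "diag_matrix p = (\<chi> i j. if i = j then p $ i else 0)"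

definition outer_product :: "real ^ 'm::finite \<Rightarrow> real ^ 'n::finite \<Rightarrow> real ^ 'n ^ 'm" where
  "outer_product p q = (\<chi> i j. p $ i * q $ j)"

definition real_eigenvalue :: "real ^ 'n::finite ^ 'n \<Rightarrow> real \<Rightarrow> bool" where
  "real_eigenvalue M k \<longleftrightarrow> (\<exists>v. v \<noteq> 0 \<and> M *v v = k *\<^sub>R v)"

(* Max is unspecified on an infinite or empty set; for symmetric M neither occurs, see
   lambda_max_symmetric below. *)
definition lambda_max :: "real ^ 'n::finite ^ 'n \<Rightarrow> real" where
  "lambda_max M = Max {k. real_eigenvalue M k}"

lemma finite_real_eigenvalues_symmetric:
  fixes M :: "real ^ 'n::finite ^ 'n"
  assumes sym: "transpose M = M"
  shows "finite {k. real_eigenvalue M k}"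
proof -
  let ?E = "{k. real_eigenvalue M k}"
  have "\<forall>k\<in>?E. \<exists>v. v \<noteq> 0 \<and> M *v v = k *\<^sub>R v"
    by (simp add: real_eigenvalue_def)
  then obtain f where f: "\<And>k. k \<in> ?E \<Longrightarrow> f k \<noteq> 0 \<and> M *v f k = k *\<^sub>R f k"
    by metis
  have orth: "f k \<bullet> f l = 0" if "k \<in> ?E" "l \<in> ?E" "k \<noteq> l" for k l
  proof -
    have "(M *v f k) \<bullet> f l = f k \<bullet> (M *v f l)"
      by (metis dot_lmul_matrix sym vector_transpose_matrix)
    then have "k * (f k \<bullet> f l) = l * (f k \<bullet> f l)"
      using f that by simp
    then show ?thesis using that by simp
  qed
  have inj: "inj_on f ?E"
    using orth f by (metis inj_onI inner_eq_zero_iff)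
  have "pairwise orthogonal (f ` ?E)"
    using orth by (force simp: pairwise_def orthogonal_def)
  moreover have "0 \<notin> f ` ?E" using f by force
  ultimately have "finite (f ` ?E)"
    using pairwise_orthogonal_independent finiteI_independent by blast
  then show ?thesis using inj finite_imageD by blast
qed

lemma ex_real_eigenvalue_symmetric:
  fixes M :: "real ^ 'n::finite ^ 'n"
  assumes sym: "transpose M = M"
  shows "\<exists>k. real_eigenvalue M k"
proof -
  have sa: "(M *v x) \<bullet> y = x \<bullet> (M *v y)" for x y
    by (metis dot_lmul_matrix sym vector_transpose_matrix)
  have "continuous_on (sphere 0 1) (\<lambda>x. x \<bullet> (M *v x))"
    by (intro continuous_intros linear_continuous_on matrix_vector_mul_bounded_linear)
  moreover have "sphere (0::real^'n) 1 \<noteq> {}" by simp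
  ultimately obtain x where x: "x \<in> sphere 0 1"
    and mx: "\<And>y. y \<in> sphere 0 1 \<Longrightarrow> y \<bullet> (M *v y) \<le> x \<bullet> (M *v x)"
    using continuous_attains_sup[OF compact_sphere] by blast
  define k where "k = x \<bullet> (M *v x)"
  define B where "B = (\<lambda>y. k *\<^sub>R y - M *v y)"
  have nx: "norm x = 1" using x by simp
  have psd: "0 \<le> y \<bullet> B y" for y
  proof (cases "y = 0")
    case False
    have "(y /\<^sub>R norm y) \<bullet> (M *v (y /\<^sub>R norm y)) \<le> k"
      unfolding k_def using False by (intro mx) simp
    then have "y \<bullet> (M *v y) \<le> k * (norm y)\<^sup>2"
      using False by (simp add: matrix_vector_mult_scaleR field_simps power2_eq_square)
    then show ?thesis
      by (simp add: B_def inner_diff_right power2_norm_eq_inner)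
  qed (simp add: B_def)
  have B0: "x \<bullet> B x = 0"
    using nx by (simp add: B_def inner_diff_right k_def norm_eq_1)
  have expand: "(x + t *\<^sub>R B x) \<bullet> B (x + t *\<^sub>R B x) = 
      2 * t * (B x \<bullet> B x) + t\<^sup>2 * (B x \<bullet> B (B x))" for t
  proof -
    have Bl: "B (x + t *\<^sub>R y) = B x + t *\<^sub>R B y" for y
      by (simp add: B_def algebra_simps)
    have "x \<bullet> B y = B x \<bullet> y" for y
      by (simp add: B_def inner_diff_right inner_diff_left sa)
    then show ?thesis
      unfolding Bl using B0 by (simp add: power2_eq_square algebra_simps)
  qed
  have "B x = 0"
  proof (rule ccontr)
    assume "B x \<noteq> 0"
    define c where "c = B x \<bullet> B x"
    define q where "q = B x \<bullet> B (B x)"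
    have c: "c > 0" using \<open>B x \<noteq> 0\<close> by (simp add: c_def)
    have q: "q \<ge> 0" using psd[of "B x"] by (simp add: q_def)
    define t where "t = - c / (q + 1)"
    have "0 \<le> 2 * t * c + t\<^sup>2 * q"
      using psd[of "x + t *\<^sub>R B x"] expand[of t] by (simp add: c_def q_def)
    also have "2 * t * c + t\<^sup>2 * q = - (c\<^sup>2 * (q + 2)) / (q + 1)\<^sup>2"
    proof -
      have "t * (q + 1) = - c" using q by (simp add: t_def)
      then have "(2 * t * c + t\<^sup>2 * q) * (q + 1)\<^sup>2 = - (c\<^sup>2 * (q + 2))"
        by algebra
      then show ?thesis using q by (subst nonzero_eq_divide_eq) auto
    qed
    also have "\<dots> < 0" using c q by (simp add: divide_neg_pos)
    finally show False by simp
  qed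
  then have "M *v x = k *\<^sub>R x" by (simp add: B_def)
  moreover have "x \<noteq> 0" using nx by auto
  ultimately show ?thesis by (auto simp: real_eigenvalue_def)
qed

lemma lambda_max_symmetric:
  fixes M :: "real ^ 'n::finite ^ 'n"
  assumes "transpose M = M"
  shows "real_eigenvalue M (lambda_max M)"
    and "\<And>k. real_eigenvalue M k \<Longrightarrow> k \<le> lambda_max M"
proof -
  let ?E = "{k. real_eigenvalue M k}"
  have fin: "finite ?E" using finite_real_eigenvalues_symmetric[OF assms] .
  have "?E \<noteq> {}" using ex_real_eigenvalue_symmetric[OF assms] by simp
  then show "real_eigenvalue M (lambda_max M)"
    using Max_in[OF fin] by (simp add: lambda_max_def)
  show "k \<le> lambda_max M" if "real_eigenvalue M k" for k
    using Max_ge[OF fin] that by (simp add: lambda_max_def)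
qed

end

theory Submission
  imports Defs
begin

text \<open>The expected reward is smooth along the iteration, so the step size makes it increase by at
  least a multiple of the squared gradient norm, and the gradients tend to zero. Pairing the
  gradient with the vector of assumption (a) gives a covariance of two equally ordered
  functions, so all products of two action probabilities tend to zero and the expected reward tends to
  some r(i). By monotonicity this is not the smallest one. If it is the middle
  one, the expected reward never exceeds r(2), and assumption (b) then makes the ratio of
  the first to the third probability nondecreasing. As that ratio is also bounded, the
  probabilities of actions 1 and 3 are summable; so the increments of the parameters are
  summable and the parameters converge, which contradicts that the first probability tends to zero.\<close>

section \<open>Rayleigh quotients\<close>

text \<open>A nonnegative quadratic that vanishes at 0 is minimal there, so its slope at 0 is zero.
  This serves as the first-order condition at a maximizer of a quadratic form.\<close>

lemma linear_coeff_zero: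
  fixes b c :: real
  assumes "\<And>t. 0 \<le> t * b + t\<^sup>2 * c"
  shows "b = 0"
proof (rule ccontr)
  assume b: "b \<noteq> 0"
  define d where "d = \<bar>c\<bar> + 1"
  have d: "d > 0" "c < d" by (auto simp: d_def)
  \<comment> \<open>The test point \<open>- b / d\<close> moves against the slope; since
    \<open>d\<close> exceeds \<open>c\<close>, the linear term outweighs the quadratic one.\<close>
  have "0 \<le> (- b / d) * b + (- b / d)\<^sup>2 * c" by (rule assms)
  also have "\<dots> = (b\<^sup>2 / d) * (c / d - 1)"
    using d by (simp add: power2_eq_square field_simps)
  also have "\<dots> < 0"
    using b d by (intro mult_pos_neg) auto
  finally show False by simp
qed

text \<open>By compactness the quadratic form attains a maximum \<open>k\<close> on the unit sphere.
  Stationarity makes the maximizer an eigenvector for \<open>k\<close>, so \<open>k\<close> is at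
  most \<open>lambda_max M\<close>; homogeneity covers all other vectors.\<close>

lemma rayleigh_le_lambda_max:
  fixes M :: "real ^ 'n::finite ^ 'n"
  assumes sym: "transpose M = M"
  shows "y \<bullet> (M *v y) \<le> lambda_max M * (norm y)\<^sup>2"
proof -
  have sa: "(M *v x) \<bullet> y = x \<bullet> (M *v y)" for x y
    by (metis dot_lmul_matrix sym vector_transpose_matrix)
  have "continuous_on (sphere 0 1) (\<lambda>x. x \<bullet> (M *v x))"
    by (intro continuous_intros linear_continuous_on matrix_vector_mul_bounded_linear)
  moreover have "sphere (0::real^'n) 1 \<noteq> {}" by simp
  ultimately obtain x where "x \<in> sphere 0 1"
    and mx: "\<And>y. y \<in> sphere 0 1 \<Longrightarrow> y \<bullet> (M *v y) \<le> x \<bullet> (M *v x)"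
    using continuous_attains_sup[OF compact_sphere] by blast
  then have x: "norm x = 1" by simp
  define k where "k = x \<bullet> (M *v x)"
  have psd: "y \<bullet> (M *v y) \<le> k * (norm y)\<^sup>2" for y
  proof (cases "y = 0")
    case False
    have "(y /\<^sub>R norm y) \<bullet> (M *v (y /\<^sub>R norm y)) \<le> k"
      unfolding k_def using False by (intro mx) simp
    then show ?thesis
      using False by (simp add: matrix_vector_mult_scaleR field_simps power2_eq_square)
  qed simp
  have "(k *\<^sub>R x - M *v x) \<bullet> u = 0" for u
  proof -
    \<comment> \<open>This is \<open>psd\<close> at \<open>x + t *\<^sub>R u\<close>. The constant
      term cancels by the choice of \<open>k\<close>, and symmetry merges the two cross
      terms.\<close>
    have "0 \<le> t * (2 * ((k *\<^sub>R x - M *v x) \<bullet> u)) + t\<^sup>2 * (k * (norm u)\<^sup>2 - u \<bullet> (M *v u))" for t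
      using psd[of "x + t *\<^sub>R u"] x sa[of x u] unfolding power2_norm_eq_inner norm_eq_1
      by (simp add: algebra_simps matrix_vector_mult_scaleR inner_commute
            power2_eq_square k_def matrix_vector_right_distrib)
    then show ?thesis using linear_coeff_zero by fastforce
  qed
  then have "k *\<^sub>R x - M *v x = 0" by (metis inner_eq_zero_iff)
  then have "real_eigenvalue M k"
    using x unfolding real_eigenvalue_def by (metis eq_iff_diff_eq_0 norm_zero zero_neq_one)
  then have "k \<le> lambda_max M" by (rule lambda_max_symmetric(2)[OF sym])
  then show ?thesis
    using psd[of y] by (meson mult_right_mono order_trans zero_le_power2)
qed

lemma inner_transpose_mult:
  fixes X :: "real ^ 'n::finite ^ 'm::finite"
  shows "u \<bullet> (transpose X *v g) = (X *v u) \<bullet> g"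
  by (metis dot_lmul_matrix inner_commute transpose_matrix_vector)

text \<open>The left side is the quadratic form of the Gram matrix at \<open>u\<close>. This is how
  the eigenvalue in the step size bound enters.\<close>

lemma norm_matrix_mult_le_lambda_max:
  fixes X :: "real ^ 'n::finite ^ 'm::finite"
  shows "(norm (X *v u))\<^sup>2 \<le> lambda_max (transpose X ** X) * (norm u)\<^sup>2"
proof -
  have "transpose (transpose X ** X) = transpose X ** X"
    by (simp add: matrix_transpose_mul)
  from rayleigh_le_lambda_max[OF this, of u] show ?thesis
    by (simp add: matrix_vector_mul_assoc[symmetric] inner_transpose_mult power2_norm_eq_inner
        del: transpose_matrix_vector)
qed

section \<open>The softmax expected reward\<close>

lemma softmax_nth_pos: "softmax z $ a > 0"
  unfolding softmax_def by (auto intro!: divide_pos_pos sum_pos)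

lemma sum_softmax: "(\<Sum>a\<in>UNIV. softmax z $ a) = 1"
proof -
  have "(\<Sum>b\<in>UNIV. exp (z $ b)) > 0" by (rule sum_pos) auto
  then show ?thesis by (simp add: softmax_def sum_divide_distrib[symmetric])
qed

lemma softmax_nth_eq_exp_mult: "softmax z $ a = exp (z $ a - z $ b) * softmax z $ b"
  by (simp add: softmax_def exp_diff)

lemma continuous_on_softmax_nth [continuous_intros]:
  assumes "continuous_on S f"
  shows "continuous_on S (\<lambda>x. softmax (f x) $ a)"
proof -
  have "(\<Sum>b\<in>UNIV. exp (f x $ b)) \<noteq> 0" for x
    by (rule less_imp_neq[symmetric], rule sum_pos) auto
  then show ?thesis unfolding softmax_def using assms
    by (auto intro!: continuous_intros)
qed

text \<open>The gradient of the expected reward with respect to the logits, as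
  \<open>reward_line_derivative\<close> shows. The matrix form is that of the update rule.\<close>

definition logit_gradient :: "real ^ 'k::finite \<Rightarrow> real ^ 'k \<Rightarrow> real ^ 'k" where
  "logit_gradient r z = (diag_matrix (softmax z) - outer_product (softmax z) (softmax z)) *v r"

lemma logit_gradient_nth:
  "logit_gradient r z $ a = softmax z $ a * (r $ a - softmax z \<bullet> r)"
proof -
  have "logit_gradient r z $ a =
      (\<Sum>j\<in>UNIV. (if a = j then softmax z $ a * r $ j else 0) - softmax z $ a * (softmax z $ j * r $ j))"
    unfolding logit_gradient_def diag_matrix_def outer_product_def matrix_vector_mult_def
    by (auto intro!: sum.cong simp: algebra_simps)
  also have "\<dots> = softmax z $ a * r $ a - softmax z $ a * (softmax z \<bullet> r)"
    by (simp add: sum_subtractf inner_vec_def sum_distrib_left)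
  finally show ?thesis by (simp add: right_diff_distrib)
qed

text \<open>Adding one constant to all logits leaves the policy unchanged, so the gradient is
  orthogonal to the all-ones vector.\<close>

lemma sum_logit_gradient: "(\<Sum>a\<in>UNIV. logit_gradient r z $ a) = 0"
proof -
  have "(\<Sum>a\<in>UNIV. logit_gradient r z $ a) = softmax z \<bullet> r - (\<Sum>a\<in>UNIV. softmax z $ a) * (softmax z \<bullet> r)"
    unfolding logit_gradient_nth
    by (simp add: right_diff_distrib sum_subtractf inner_vec_def sum_distrib_right)
  then show ?thesis by (simp add: sum_softmax)
qed

lemma abs_reward_le:
  assumes "\<And>a. \<bar>r $ a\<bar> \<le> R"
  shows "\<bar>softmax z \<bullet> r\<bar> \<le> R"
proof -
  have "\<bar>softmax z \<bullet> r\<bar> \<le> (\<Sum>a\<in>UNIV. softmax z $ a * R)"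
    unfolding inner_vec_def
    by (rule sum_abs[THEN order_trans], rule sum_mono)
      (auto simp: abs_mult softmax_nth_pos less_imp_le intro!: mult_left_mono assms)
  then show ?thesis by (simp add: sum_distrib_right[symmetric] sum_softmax)
qed

section \<open>Derivatives along a line of logits\<close>

lemma softmax_line_derivative:
  "((\<lambda>t. softmax (z + t *\<^sub>R v) $ a) has_real_derivative
     softmax (z + t *\<^sub>R v) $ a * (v $ a - softmax (z + t *\<^sub>R v) \<bullet> v)) (at t)"
proof -
  define Z where "Z t = (\<Sum>b\<in>UNIV. exp (z $ b + t * v $ b))" for t
  have Z: "Z t > 0" for t unfolding Z_def by (rule sum_pos) auto
  have "(Z has_real_derivative (\<Sum>b\<in>UNIV. exp (z $ b + t * v $ b) * v $ b)) (at t)"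
    unfolding Z_def by (auto intro!: derivative_eq_intros)
  moreover have "(\<Sum>b\<in>UNIV. exp (z $ b + t * v $ b) * v $ b) = Z t * (softmax (z + t *\<^sub>R v) \<bullet> v)"
    using Z[of t] by (simp add: inner_vec_def softmax_def Z_def[symmetric] sum_distrib_left)
  ultimately have dZ: "(Z has_real_derivative Z t * (softmax (z + t *\<^sub>R v) \<bullet> v)) (at t)"
    by simp
  have "((\<lambda>t. exp (z $ a + t * v $ a) / Z t) has_real_derivative
      exp (z $ a + t * v $ a) / Z t * (v $ a - softmax (z + t *\<^sub>R v) \<bullet> v)) (at t)"
    using Z[of t] by (auto intro!: derivative_eq_intros dZ simp: field_simps)
  then show ?thesis by (simp add: softmax_def Z_def)
qed

lemma reward_line_derivative:
  "((\<lambda>t. softmax (z + t *\<^sub>R v) \<bullet> r) has_real_derivative v \<bullet> logit_gradient r (z + t *\<^sub>R v)) (at t)"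
proof -
  let ?p = "softmax (z + t *\<^sub>R v)"
  have "((\<lambda>t. \<Sum>a\<in>UNIV. softmax (z + t *\<^sub>R v) $ a * r $ a) has_real_derivative
      (\<Sum>a\<in>UNIV. ?p $ a * (v $ a - ?p \<bullet> v) * r $ a)) (at t)"
    by (rule DERIV_sum) (auto intro!: DERIV_cmult_right softmax_line_derivative)
  \<comment> \<open>Both sides are the covariance of \<open>v\<close> and \<open>r\<close> under the
    current policy.\<close>
  moreover have "(\<Sum>a\<in>UNIV. ?p $ a * (v $ a - ?p \<bullet> v) * r $ a) = v \<bullet> logit_gradient r (z + t *\<^sub>R v)"
  proof -
    have "(\<Sum>a\<in>UNIV. ?p $ a * (v $ a - ?p \<bullet> v) * r $ a) =
        (\<Sum>a\<in>UNIV. ?p $ a * v $ a * r $ a) - (?p \<bullet> v) * (?p \<bullet> r)"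
      unfolding inner_vec_def[of ?p r]
      by (simp add: algebra_simps sum_subtractf sum_distrib_left)
    moreover have "v \<bullet> logit_gradient r (z + t *\<^sub>R v) =
        (\<Sum>a\<in>UNIV. ?p $ a * v $ a * r $ a) - (?p \<bullet> v) * (?p \<bullet> r)"
      unfolding inner_vec_def[of v] inner_vec_def[of ?p v] logit_gradient_nth
      by (simp add: algebra_simps sum_subtractf sum_distrib_left)
    ultimately show ?thesis by simp
  qed
  ultimately show ?thesis by (simp add: inner_vec_def)
qed

text \<open>The first derivative is a covariance; differentiating once more gives a third central
  mixed moment. In this form it is bounded by the variance of \<open>v\<close> times the largest
  deviation of the reward from its mean.\<close>

lemma reward_line_second_derivative:
  fixes z v r :: "real ^ 'k::finite" and t :: real
  defines "p \<equiv> softmax (z + t *\<^sub>R v)"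
  shows "((\<lambda>t. v \<bullet> logit_gradient r (z + t *\<^sub>R v)) has_real_derivative
     (\<Sum>a\<in>UNIV. p $ a * (v $ a - p \<bullet> v)\<^sup>2 * (r $ a - p \<bullet> r))) (at t)"
proof -
  let ?m = "p \<bullet> v" and ?J = "p \<bullet> r" and ?D = "v \<bullet> logit_gradient r (z + t *\<^sub>R v)"
  have term_deriv: "((\<lambda>t. v $ a * (softmax (z + t *\<^sub>R v) $ a * (r $ a - softmax (z + t *\<^sub>R v) \<bullet> r)))
      has_real_derivative v $ a * (p $ a * (v $ a - ?m) * (r $ a - ?J) - p $ a * ?D)) (at t)" for a
    unfolding p_def
    by (auto intro!: derivative_eq_intros softmax_line_derivative reward_line_derivative
        simp: algebra_simps)
  have "((\<lambda>t. v \<bullet> logit_gradient r (z + t *\<^sub>R v)) has_real_derivative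
      (\<Sum>a\<in>UNIV. v $ a * (p $ a * (v $ a - ?m) * (r $ a - ?J) - p $ a * ?D))) (at t)"
    unfolding inner_vec_def[of v "logit_gradient r _"] logit_gradient_nth inner_real_def
    by (rule DERIV_sum) (rule term_deriv[unfolded inner_vec_def[of v "logit_gradient r _"]
        logit_gradient_nth inner_real_def])
  moreover have "(\<Sum>a\<in>UNIV. v $ a * (p $ a * (v $ a - ?m) * (r $ a - ?J) - p $ a * ?D)) =
      (\<Sum>a\<in>UNIV. p $ a * (v $ a - ?m)\<^sup>2 * (r $ a - ?J))"
  proof -
    \<comment> \<open>Centering \<open>v\<close> changes nothing because the gradient coordinates
      sum to zero.\<close>
    have D: "?D = (\<Sum>a\<in>UNIV. p $ a * (v $ a - ?m) * (r $ a - ?J))"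
    proof -
      have "(\<Sum>a\<in>UNIV. p $ a * (v $ a - ?m) * (r $ a - ?J)) =
          ?D - ?m * (\<Sum>a\<in>UNIV. logit_gradient r (z + t *\<^sub>R v) $ a)"
        unfolding inner_vec_def[of v "logit_gradient r _"] logit_gradient_nth p_def[symmetric]
        by (simp add: sum_distrib_left sum_subtractf[symmetric] algebra_simps)
      then show ?thesis by (simp add: sum_logit_gradient)
    qed
    have "(\<Sum>a\<in>UNIV. v $ a * (p $ a * (v $ a - ?m) * (r $ a - ?J) - p $ a * ?D)) =
        (\<Sum>a\<in>UNIV. v $ a * (p $ a * (v $ a - ?m) * (r $ a - ?J))) - ?m * ?D"
      by (simp add: inner_vec_def[of p v] sum_distrib_left sum_distrib_right sum_subtractf sum.distrib
          algebra_simps)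
    also have "\<dots> = (\<Sum>a\<in>UNIV. p $ a * (v $ a - ?m)\<^sup>2 * (r $ a - ?J))"
      unfolding D
      by (simp add: sum_distrib_left sum_subtractf[symmetric] power2_eq_square algebra_simps)
    finally show ?thesis .
  qed
  ultimately show ?thesis by simp
qed

section \<open>Smoothness and ascent of the expected reward\<close>

lemma softmax_variance_le:
  fixes z v :: "real ^ 'k::finite"
  shows "(\<Sum>a\<in>UNIV. softmax z $ a * (v $ a - softmax z \<bullet> v)\<^sup>2) \<le> (norm v)\<^sup>2"
proof -
  let ?p = "softmax z" and ?m = "softmax z \<bullet> v"
  have "(\<Sum>a\<in>UNIV. ?p $ a * (v $ a - ?m)\<^sup>2) =
      (\<Sum>a\<in>UNIV. ?p $ a * (v $ a)\<^sup>2 - 2 * ?m * (?p $ a * v $ a) + ?m\<^sup>2 * ?p $ a)"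
    by (simp add: power2_eq_square algebra_simps)
  also have "\<dots> = (\<Sum>a\<in>UNIV. ?p $ a * (v $ a)\<^sup>2) - 2 * ?m * (\<Sum>a\<in>UNIV. ?p $ a * v $ a)
      + ?m\<^sup>2 * (\<Sum>a\<in>UNIV. ?p $ a)"
    by (simp only: sum.distrib sum_subtractf sum_distrib_left)
  also have "\<dots> = (\<Sum>a\<in>UNIV. ?p $ a * (v $ a)\<^sup>2) - ?m\<^sup>2"
    unfolding sum_softmax by (simp add: inner_vec_def power2_eq_square)
  also have "\<dots> \<le> (\<Sum>a\<in>UNIV. ?p $ a * (v $ a)\<^sup>2)" by simp
  also have "\<dots> \<le> (\<Sum>a\<in>UNIV. (v $ a)\<^sup>2)"
  proof (rule sum_mono)
    fix a
    have "?p $ a \<le> 1"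
      using member_le_sum[of a UNIV "\<lambda>a. ?p $ a"] by (simp add: sum_softmax softmax_nth_pos less_imp_le)
    then show "?p $ a * (v $ a)\<^sup>2 \<le> (v $ a)\<^sup>2"
      by (simp add: mult_left_le_one_le softmax_nth_pos less_imp_le)
  qed
  also have "\<dots> = (norm v)\<^sup>2"
    unfolding power2_norm_eq_inner by (simp add: inner_vec_def power2_eq_square)
  finally show ?thesis .
qed

text \<open>Second-order Taylor expansion along the segment from \<open>z\<close> to
  \<open>z + v\<close>. Rewards deviate from their mean by at most \<open>2 * R\<close> and the
  variance of \<open>v\<close> is at most its squared norm; the factor 1/2 of the remainder leaves
  \<open>R\<close>.\<close>

lemma reward_ascent:
  fixes z v r :: "real ^ 'k::finite"
  assumes R: "\<And>a. \<bar>r $ a\<bar> \<le> R"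
  shows "softmax (z + v) \<bullet> r \<ge> softmax z \<bullet> r + v \<bullet> logit_gradient r z - R * (norm v)\<^sup>2"
proof -
  define p where "p t = softmax (z + t *\<^sub>R v)" for t
  define J'' where "J'' t = (\<Sum>a\<in>UNIV. p t $ a * (v $ a - p t \<bullet> v)\<^sup>2 * (r $ a - p t \<bullet> r))" for t
  \<comment> \<open>The reward and its first two derivatives along the segment, indexed by order as
    \<open>Maclaurin\<close> expects.\<close>
  define diff :: "nat \<Rightarrow> real \<Rightarrow> real" where "diff = (\<lambda>m t. if m = 0 then p t \<bullet> r
    else if m = 1 then v \<bullet> logit_gradient r (z + t *\<^sub>R v) else J'' t)"
  have "\<exists>t>0. t < 1 \<and> p 1 \<bullet> r = (\<Sum>m<2. diff m 0 / fact m * 1 ^ m) + diff 2 t / fact 2 * 1 ^ 2"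
  proof (rule Maclaurin)
    show "\<forall>m t. m < 2 \<and> 0 \<le> t \<and> t \<le> 1 \<longrightarrow> (diff m has_real_derivative diff (Suc m) t) (at t)"
      using reward_line_derivative[of z v r] reward_line_second_derivative[of v r z]
      by (auto simp: diff_def p_def J''_def less_2_cases_iff)
  qed (auto simp: diff_def)
  then obtain t where "p 1 \<bullet> r = p 0 \<bullet> r + v \<bullet> logit_gradient r z + J'' t / 2"
    by (auto simp: diff_def eval_nat_numeral)
  moreover have "J'' t \<ge> - 2 * R * (norm v)\<^sup>2"
  proof -
    have "R \<ge> 0" using R[of undefined] by linarith
    have "r $ a - p t \<bullet> r \<ge> - 2 * R" for a
      using R[of a] abs_reward_le[of r R "z + t *\<^sub>R v", OF R] unfolding p_def by linarith
    then have "J'' t \<ge> (\<Sum>a\<in>UNIV. p t $ a * (v $ a - p t \<bullet> v)\<^sup>2 * (- 2 * R))"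
      unfolding J''_def p_def
      by (intro sum_mono mult_left_mono) (auto simp: softmax_nth_pos less_imp_le)
    moreover have "(\<Sum>a\<in>UNIV. p t $ a * (v $ a - p t \<bullet> v)\<^sup>2 * (2 * R)) \<le> (norm v)\<^sup>2 * (2 * R)"
      unfolding sum_distrib_right[symmetric] p_def
      by (intro mult_right_mono softmax_variance_le) (simp add: \<open>R \<ge> 0\<close>)
    ultimately show ?thesis
      by (simp add: sum_negf algebra_simps)
  qed
  ultimately show ?thesis by (simp add: p_def)
qed

text \<open>A parameter step along \<open>g \<theta>\<close> moves the logits by \<open>?v\<close>.
  The adjoint turns the first-order gain into a squared gradient norm, and the Gram eigenvalue
  bounds the second-order loss by a multiple of that same norm.\<close>

lemma gradient_step_ascent:
  fixes X :: "real ^ 'd::finite ^ 'k::finite" and r :: "real ^ 'k"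
  defines "g \<equiv> \<lambda>\<theta>. transpose X *v logit_gradient r (X *v \<theta>)"
  assumes R: "\<And>a. \<bar>r $ a\<bar> \<le> R" and "0 \<le> \<eta>"
  shows "softmax (X *v (\<theta> + \<eta> *\<^sub>R g \<theta>)) \<bullet> r \<ge>
    softmax (X *v \<theta>) \<bullet> r + \<eta> * (1 - \<eta> * R * lambda_max (transpose X ** X)) * (norm (g \<theta>))\<^sup>2"
proof -
  let ?v = "\<eta> *\<^sub>R (X *v g \<theta>)"
  have "R \<ge> 0" using R[of undefined] by linarith
  have "?v \<bullet> logit_gradient r (X *v \<theta>) = \<eta> * (norm (g \<theta>))\<^sup>2"
    unfolding power2_norm_eq_inner by (simp add: g_def inner_transpose_mult del: transpose_matrix_vector)
  moreover have "R * (norm ?v)\<^sup>2 \<le> R * (\<eta>\<^sup>2 * (lambda_max (transpose X ** X) * (norm (g \<theta>))\<^sup>2))"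
    using \<open>R \<ge> 0\<close> by (simp add: power_mult_distrib norm_matrix_mult_le_lambda_max mult_left_mono)
  moreover have step: "X *v (\<theta> + \<eta> *\<^sub>R g \<theta>) = X *v \<theta> + ?v"
    by (simp add: matrix_vector_right_distrib matrix_vector_mult_scaleR)
  moreover have "\<eta> * (1 - \<eta> * R * lambda_max (transpose X ** X)) * (norm (g \<theta>))\<^sup>2 =
      \<eta> * (norm (g \<theta>))\<^sup>2 - R * (\<eta>\<^sup>2 * (lambda_max (transpose X ** X) * (norm (g \<theta>))\<^sup>2))"
    by algebra
  ultimately show ?thesis
    using reward_ascent[of r R "X *v \<theta>" ?v, OF R] unfolding step by linarith
qed

section \<open>Three actions\<close>

lemma null_comparison:
  assumes "\<And>t. norm (f t) \<le> h t" "h \<longlonglongrightarrow> 0"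
  shows "f \<longlonglongrightarrow> 0"
  using assms by (intro Lim_null_comparison[of f h]) auto

lemma sum_softmax_3: "softmax (z :: real ^ 3) $ 1 + softmax z $ 2 + softmax z $ 3 = 1"
  using sum_softmax[of z] by (simp add: sum_3)

lemma reward_3: "softmax (z :: real ^ 3) \<bullet> r =
    softmax z $ 1 * r $ 1 + softmax z $ 2 * r $ 2 + softmax z $ 3 * r $ 3"
  by (simp add: inner_vec_def sum_3)

text \<open>A covariance as a sum over unordered pairs of actions. All terms are nonnegative when
  \<open>v\<close> and \<open>r\<close> order the actions alike.\<close>

lemma inner_logit_gradient_3:
  fixes z v r :: "real ^ 3"
  defines "p \<equiv> softmax z"
  shows "v \<bullet> logit_gradient r z =
      p $ 1 * p $ 2 * ((v $ 1 - v $ 2) * (r $ 1 - r $ 2))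
    + p $ 1 * p $ 3 * ((v $ 1 - v $ 3) * (r $ 1 - r $ 3))
    + p $ 2 * p $ 3 * ((v $ 2 - v $ 3) * (r $ 2 - r $ 3))"
proof -
  have p: "p $ 1 = 1 - p $ 2 - p $ 3" using sum_softmax_3[of z] by (simp add: p_def)
  show ?thesis
    unfolding inner_vec_def[of v] sum_3 logit_gradient_nth reward_3 inner_real_def
    unfolding p_def[symmetric] p by algebra
qed

text \<open>Convergence of the policies is not assumed, so the limit is identified as a root of the
  cubic polynomial whose roots are the three rewards.\<close>

lemma reward_limit_3:
  fixes z :: "nat \<Rightarrow> real ^ 3" and r :: "real ^ 3"
  defines "p \<equiv> \<lambda>t. softmax (z t)"
  assumes p0: "(\<lambda>t. p t $ 1 * p t $ 2) \<longlonglongrightarrow> 0" "(\<lambda>t. p t $ 1 * p t $ 3) \<longlonglongrightarrow> 0"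
      "(\<lambda>t. p t $ 2 * p t $ 3) \<longlonglongrightarrow> 0"
    and l: "(\<lambda>t. p t \<bullet> r) \<longlonglongrightarrow> l"
  shows "l = r $ 1 \<or> l = r $ 2 \<or> l = r $ 3"
proof -
  have bnd: "0 \<le> p t $ a" "p t $ a \<le> 1" for t a
    using member_le_sum[of a UNIV "\<lambda>a. p t $ a"]
    by (simp_all add: p_def sum_softmax softmax_nth_pos less_imp_le)
  have p3: "(\<lambda>t. p t $ i * p t $ j * p t $ 3) \<longlonglongrightarrow> 0"
    if "(\<lambda>t. p t $ i * p t $ j) \<longlonglongrightarrow> 0" for i j
    by (rule null_comparison[OF _ that]) (auto simp: abs_mult bnd intro!: mult_left_le)
  define a b where "a = r $ 1 - r $ 2" and "b = r $ 2 - r $ 3"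
  \<comment> \<open>The reward minus r(i) does not involve the i-th probability, so every monomial of the
    product of these three differences contains two different probabilities.\<close>
  have "(p t \<bullet> r - r $ 1) * (p t \<bullet> r - r $ 2) * (p t \<bullet> r - r $ 3) =
      p t $ 1 * p t $ 2 * (p t \<bullet> r - r $ 3) * (- a\<^sup>2)
    + (p t $ 1 * p t $ 3 * (p t \<bullet> r - r $ 3) * (- a * (a + b)) + p t $ 1 * p t $ 3 * p t $ 3 * (b * (a + b)\<^sup>2))
    + (p t $ 2 * p t $ 3 * (p t \<bullet> r - r $ 3) * (a * b) + p t $ 2 * p t $ 3 * p t $ 3 * (b\<^sup>2 * (a + b)))" for t
  proof -
    have "p t $ 2 = 1 - p t $ 1 - p t $ 3" using sum_softmax_3[of "z t"] by (simp add: p_def)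
    moreover have "p t \<bullet> r = p t $ 1 * r $ 1 + p t $ 2 * r $ 2 + p t $ 3 * r $ 3"
      by (simp add: p_def reward_3)
    moreover have "r $ 1 = r $ 3 + b + a" "r $ 2 = r $ 3 + b" by (auto simp: a_def b_def)
    ultimately show ?thesis by algebra
  qed
  moreover have "(\<lambda>t. p t $ 1 * p t $ 2 * (p t \<bullet> r - r $ 3) * (- a\<^sup>2)
    + (p t $ 1 * p t $ 3 * (p t \<bullet> r - r $ 3) * (- a * (a + b)) + p t $ 1 * p t $ 3 * p t $ 3 * (b * (a + b)\<^sup>2))
    + (p t $ 2 * p t $ 3 * (p t \<bullet> r - r $ 3) * (a * b) + p t $ 2 * p t $ 3 * p t $ 3 * (b\<^sup>2 * (a + b))))
    \<longlonglongrightarrow> 0 * (l - r $ 3) * (- a\<^sup>2) + (0 * (l - r $ 3) * (- a * (a + b)) + 0 * (b * (a + b)\<^sup>2))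
      + (0 * (l - r $ 3) * (a * b) + 0 * (b\<^sup>2 * (a + b)))"
    by (intro tendsto_intros p0 l p3)
  ultimately have "(\<lambda>t. (p t \<bullet> r - r $ 1) * (p t \<bullet> r - r $ 2) * (p t \<bullet> r - r $ 3)) \<longlonglongrightarrow> 0"
    by simp
  moreover have "(\<lambda>t. (p t \<bullet> r - r $ 1) * (p t \<bullet> r - r $ 2) * (p t \<bullet> r - r $ 3))
      \<longlonglongrightarrow> (l - r $ 1) * (l - r $ 2) * (l - r $ 3)"
    by (intro tendsto_intros l)
  ultimately have "(l - r $ 1) * (l - r $ 2) * (l - r $ 3) = 0"
    using LIMSEQ_unique by blast
  then show ?thesis by simp
qed

section \<open>Excluding the middle reward as the limit\<close>

lemma convergent_if_summable_increments:
  fixes u g :: "nat \<Rightarrow> 'a::banach"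
  assumes "\<And>t. u (Suc t) = u t + \<eta> *\<^sub>R g t" "summable g"
  shows "convergent u"
proof -
  have "u n = u 0 + \<eta> *\<^sub>R (\<Sum>i<n. g i)" for n
    by (induction n) (auto simp: assms(1) algebra_simps)
  then have "u = (\<lambda>n. u 0 + \<eta> *\<^sub>R (\<Sum>i<n. g i))" by blast
  moreover have "(\<lambda>n. u 0 + \<eta> *\<^sub>R (\<Sum>i<n. g i)) \<longlonglongrightarrow> u 0 + \<eta> *\<^sub>R suminf g"
    by (intro tendsto_intros summable_LIMSEQ assms(2))
  ultimately show ?thesis using convergentI by metis
qed

text \<open>The argument follows \<open>D\<close>, the logit gap between actions 1 and 3: each step
  raises it by at least a multiple of the first probability, yet it stays bounded. The resulting
  summability makes the parameters converge, and softmax is positive at their limit.\<close>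

lemma not_middle_reward_limit:
  fixes u :: "nat \<Rightarrow> real ^ 'd::finite" and X :: "real ^ 'd ^ 3" and r :: "real ^ 3"
  defines "p \<equiv> \<lambda>t. softmax (X *v u t)"
    and "g \<equiv> \<lambda>t. transpose X *v logit_gradient r (X *v u t)"
  assumes step: "\<And>t. u (Suc t) = u t + \<eta> *\<^sub>R g t" and "0 < \<eta>"
    and r: "r $ 1 > r $ 2" "r $ 2 > r $ 3"
    and R: "\<And>a. \<bar>r $ a\<bar> \<le> R"
    and geom: "(X $ 2 - X $ 3) \<bullet> (X $ 1 - X $ 3) > 0"
    and le: "\<And>t. p t \<bullet> r \<le> r $ 2"
  shows "\<not> (\<lambda>t. p t $ 1) \<longlonglongrightarrow> 0"
proof
  assume p1_0: "(\<lambda>t. p t $ 1) \<longlonglongrightarrow> 0"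
  define G where "G t = logit_gradient r (X *v u t)" for t
  define d where "d = X $ 1 - X $ 3"
  define D where "D t = d \<bullet> u t" for t
  have pos: "p t $ a > 0" for t a by (simp add: p_def softmax_nth_pos)
  have sum1: "p t $ 1 + p t $ 2 + p t $ 3 = 1" for t by (simp add: p_def sum_softmax_3)
  have J: "p t \<bullet> r = p t $ 1 * r $ 1 + p t $ 2 * r $ 2 + p t $ 3 * r $ 3" for t
    by (simp add: p_def reward_3)
  have G: "G t $ a = p t $ a * (r $ a - p t \<bullet> r)" for t a
    by (simp add: G_def p_def logit_gradient_nth)
  have Gsum: "G t $ 1 + G t $ 2 + G t $ 3 = 0" for t
    using sum_logit_gradient[of r "X *v u t"] by (simp add: G_def sum_3)
  have X: "(X *v v) $ a = X $ a \<bullet> v" for v a by (simp add: matrix_vector_mul_component)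

  have ratio: "p t $ 1 = exp (D t) * p t $ 3" for t
    using softmax_nth_eq_exp_mult[of "X *v u t" 1 3]
    by (simp add: p_def X D_def d_def inner_diff_left)
  have "d \<noteq> 0" using geom by (auto simp: d_def)
  define k where "k = \<eta> * (r $ 1 - r $ 2) * (d \<bullet> d)"
  have k: "k > 0" using \<open>d \<noteq> 0\<close> \<open>0 < \<eta>\<close> r by (simp add: k_def)
  have D_step: "D (Suc t) \<ge> D t + k * p t $ 1" for t
  proof -
    have "d \<bullet> g t = (X $ 1 \<bullet> d) * G t $ 1 + (X $ 2 \<bullet> d) * G t $ 2 + (X $ 3 \<bullet> d) * G t $ 3"
      unfolding g_def inner_transpose_mult G_def[symmetric] inner_vec_def[of "X *v d"] by (simp add: sum_3 X)
    \<comment> \<open>Since the gradient coordinates sum to zero, row 3 can be subtracted from every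
      row; this produces the inner product of assumption (b).\<close>
    also have "\<dots> = G t $ 1 * (d \<bullet> d) + G t $ 2 * ((X $ 2 - X $ 3) \<bullet> d)"
    proof -
      have "X $ 1 \<bullet> d = d \<bullet> d + X $ 3 \<bullet> d" by (simp add: d_def inner_diff_left)
      then show ?thesis using Gsum[of t] unfolding inner_diff_left by algebra
    qed
    finally have "d \<bullet> g t = G t $ 1 * (d \<bullet> d) + G t $ 2 * ((X $ 2 - X $ 3) \<bullet> d)" .
    moreover have "G t $ 2 * ((X $ 2 - X $ 3) \<bullet> d) \<ge> 0"
      using geom le[of t] pos[of t 2] by (simp add: G d_def)
    \<comment> \<open>By \<open>le\<close>, the advantage of action 1 is at least
      \<open>r $ 1 - r $ 2\<close>, whence the constant \<open>k\<close>.\<close>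
    moreover have "G t $ 1 * (d \<bullet> d) \<ge> (p t $ 1 * (r $ 1 - r $ 2)) * (d \<bullet> d)"
      unfolding G using le[of t] pos[of t 1] by (intro mult_right_mono mult_left_mono) auto
    ultimately have "\<eta> * (d \<bullet> g t) \<ge> \<eta> * ((p t $ 1 * (r $ 1 - r $ 2)) * (d \<bullet> d))"
      using \<open>0 < \<eta>\<close> by (intro mult_left_mono) auto
    then show ?thesis unfolding D_def step k_def by (simp add: inner_add_right algebra_simps)
  qed
  have D_lower: "D n \<ge> D 0 + k * (\<Sum>t<n. p t $ 1)" for n
  proof (induction n)
    case (Suc n)
    then show ?case using D_step[of n] by (simp add: distrib_left)
  qed simp
  \<comment> \<open>A mean reward of at most \<open>r $ 2\<close> bounds the ratio of the first to
    the third probability, which is \<open>exp (D t)\<close>.\<close>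
  have D_upper: "D t \<le> ln ((r $ 2 - r $ 3) / (r $ 1 - r $ 2))" for t
  proof -
    have "p t \<bullet> r - r $ 2 = p t $ 1 * (r $ 1 - r $ 2) - p t $ 3 * (r $ 2 - r $ 3)"
      using sum1[of t] unfolding J by algebra
    then have "p t $ 3 * (exp (D t) * (r $ 1 - r $ 2)) \<le> p t $ 3 * (r $ 2 - r $ 3)"
      using le[of t] by (simp add: ratio algebra_simps)
    then have "exp (D t) * (r $ 1 - r $ 2) \<le> r $ 2 - r $ 3"
      using pos[of t 3] by (simp only: mult_le_cancel_left_pos)
    then have "exp (D t) \<le> (r $ 2 - r $ 3) / (r $ 1 - r $ 2)"
      using r by (simp add: pos_le_divide_eq)
    then show ?thesis using r by (simp add: ln_ge_iff)
  qed
  have sum_p1: "summable (\<lambda>t. p t $ 1)"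
  proof (rule summableI_nonneg_bounded)
    show "(\<Sum>t<n. p t $ 1) \<le> (ln ((r $ 2 - r $ 3) / (r $ 1 - r $ 2)) - D 0) / k" for n
      using D_lower[of n] D_upper[of n] k by (simp add: field_simps)
  qed (simp add: pos less_imp_le)

  obtain K where K: "K > 0" "\<And>v. norm (transpose X *v v) \<le> norm v * K"
    using bounded_linear.pos_bounded[OF matrix_vector_mul_bounded_linear[of "transpose X"]] by blast
  \<comment> \<open>The second gradient coordinate is minus the sum of the others, which avoids the
    probability of action 2, whose values are not summable. The third probability is compared with
    the first using that \<open>D\<close> never drops below \<open>D 0\<close>.\<close>
  have norm_g: "norm (g t) \<le> (4 * R * (1 + exp (- D 0)) * K) * p t $ 1" for t
  proof -
    have "R \<ge> 0" using R[of 1] by linarith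
    have Gb: "\<bar>G t $ a\<bar> \<le> p t $ a * (2 * R)" for a
    proof -
      have "\<bar>r $ a - p t \<bullet> r\<bar> \<le> 2 * R"
        using R[of a] abs_reward_le[of r R "X *v u t", OF R] unfolding p_def by linarith
      then show ?thesis unfolding G abs_mult using pos[of t a] by (simp add: mult_left_mono)
    qed
    have "D 0 \<le> D t"
      using D_lower[of t] k sum_nonneg[of "{..<t}" "\<lambda>t. p t $ 1"] pos
      by (smt (verit) mult_nonneg_nonneg)
    then have "p t $ 3 \<le> exp (- D 0) * p t $ 1"
      using pos[of t 3] by (simp add: ratio mult_exp_exp flip: mult.assoc)
    have "norm (G t) \<le> \<bar>G t $ 1\<bar> + \<bar>G t $ 2\<bar> + \<bar>G t $ 3\<bar>"
      using norm_le_l1_cart[of "G t"] by (simp add: sum_3)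
    also have "\<dots> \<le> 2 * (\<bar>G t $ 1\<bar> + \<bar>G t $ 3\<bar>)"
    proof -
      have "G t $ 2 = - (G t $ 1 + G t $ 3)" using Gsum[of t] by simp
      then show ?thesis using abs_triangle_ineq[of "G t $ 1" "G t $ 3"] by simp
    qed
    also have "\<dots> \<le> 4 * R * (p t $ 1 + p t $ 3)"
      using Gb[of 1] Gb[of 3] by (simp add: algebra_simps)
    also have "\<dots> \<le> 4 * R * (p t $ 1 + exp (- D 0) * p t $ 1)"
      using \<open>p t $ 3 \<le> _\<close> \<open>R \<ge> 0\<close> by (intro mult_left_mono) auto
    finally have "norm (G t) * K \<le> 4 * R * (p t $ 1 + exp (- D 0) * p t $ 1) * K"
      using K(1) by (intro mult_right_mono) auto
    then show ?thesis using K(2)[of "G t"] by (simp add: g_def G_def algebra_simps)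
  qed
  have "summable g"
    by (rule summable_comparison_test'[OF summable_mult[OF sum_p1]]) (rule norm_g)
  then obtain L where L: "u \<longlonglongrightarrow> L"
    using convergent_if_summable_increments[of u \<eta> g, OF step] by (auto simp: convergent_def)
  have "continuous_on UNIV (\<lambda>v. softmax (X *v v) $ 1)"
    by (intro continuous_intros linear_continuous_on matrix_vector_mul_bounded_linear)
  then have "(\<lambda>t. p t $ 1) \<longlonglongrightarrow> softmax (X *v L) $ 1"
    unfolding p_def using L by (rule continuous_on_tendsto_compose) auto
  then have "softmax (X *v L) $ 1 = 0" using p1_0 LIMSEQ_unique by blast
  then show False using softmax_nth_pos[of "X *v L" 1] by simp
qed

section \<open>Convergence to the optimal policy\<close>

theorem theorem3:
  fixes Rmax \<eta> :: real
    and r :: "real ^ 3"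
    and X :: "real ^ 'd::finite ^ 3"
    and \<theta> :: "nat \<Rightarrow> real ^ 'd"
  assumes "0 < Rmax"
    and "\<forall>a. r $ a \<in> {- Rmax .. Rmax}"
    and "r $ 1 > r $ 2" and "r $ 2 > r $ 3"
    and "CARD('d) \<le> 3"
    and "\<exists>w :: real ^ 'd. \<forall>i j. (X *v w) $ i > (X *v w) $ j \<longleftrightarrow> r $ i > r $ j"
    and "(X $ 2 - X $ 3) \<bullet> (X $ 1 - X $ 3) > 0"
    and "0 < \<eta>"
    and "\<eta> < 4 / (9 * Rmax * lambda_max (transpose X ** X))"
    and "\<forall>t\<ge>1. \<theta> (t + 1) = \<theta> t + \<eta> *\<^sub>R (transpose X *v
           ((diag_matrix (softmax (X *v \<theta> t))
             - outer_product (softmax (X *v \<theta> t)) (softmax (X *v \<theta> t))) *v r))"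
  shows "(\<lambda>t. softmax (X *v \<theta> t) $ 1) \<longlonglongrightarrow> 1"
proof -
  note r = assms(3,4)
  have R: "\<bar>r $ a\<bar> \<le> Rmax" for a using assms(2) by (simp add: abs_le_iff minus_le_iff)
  \<comment> \<open>The recursion for \<theta> starts at index 1; the shift lets \<open>u\<close>
    start at 0 and is undone at the end.\<close>
  define u where "u t = \<theta> (Suc t)" for t
  define p where "p t = softmax (X *v u t)" for t
  define G where "G t = logit_gradient r (X *v u t)" for t
  define g where "g t = transpose X *v G t" for t
  have step: "u (Suc t) = u t + \<eta> *\<^sub>R g t" for t
    using assms(10) by (simp add: u_def g_def G_def logit_gradient_def)
  have pos: "p t $ a > 0" for t a by (simp add: p_def softmax_nth_pos)
  have sum1: "p t $ 1 + p t $ 2 + p t $ 3 = 1" for t by (simp add: p_def sum_softmax_3)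
  have J: "p t \<bullet> r = p t $ 1 * r $ 1 + p t $ 2 * r $ 2 + p t $ 3 * r $ 3" for t
    by (simp add: p_def reward_3)

  define L where "L = lambda_max (transpose X ** X)"
  define c where "c = \<eta> * (1 - \<eta> * Rmax * L)"
  have "c > 0"
  proof -
    \<comment> \<open>A positive \<eta> below this quotient forces its denominator to be positive,
      which also excludes division by zero.\<close>
    have "0 < 4 / (9 * Rmax * L)" using assms(8,9) unfolding L_def by linarith
    then have "0 < 9 * Rmax * L" by (simp only: zero_less_divide_iff) simp
    then have "\<eta> * (9 * Rmax * L) < 4" using assms(9) by (simp only: L_def pos_less_divide_eq)
    then have "\<eta> * Rmax * L < 1" by simp
    then show ?thesis using assms(8) by (simp add: c_def)
  qed
  have ascent: "p (Suc t) \<bullet> r \<ge> p t \<bullet> r + c * (norm (g t))\<^sup>2" for t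
    unfolding p_def step g_def G_def c_def L_def
    using R assms(8) by (intro gradient_step_ascent) auto
  have "p t \<bullet> r \<le> p (Suc t) \<bullet> r" for t
    using ascent[of t] \<open>c > 0\<close> by (smt (verit) mult_nonneg_nonneg zero_le_power2)
  then have inc: "incseq (\<lambda>t. p t \<bullet> r)" by (simp add: incseq_SucI)
  moreover have "p t \<bullet> r \<le> Rmax" for t
    using abs_reward_le[of r Rmax "X *v u t", OF R] unfolding p_def by linarith
  ultimately obtain l where l: "(\<lambda>t. p t \<bullet> r) \<longlonglongrightarrow> l" and le_l: "\<And>t. p t \<bullet> r \<le> l"
    using incseq_convergent[of "\<lambda>t. p t \<bullet> r" Rmax] by auto

  \<comment> \<open>Increments of a convergent sequence vanish, and by \<open>ascent\<close> they
    dominate the squared gradient norms.\<close>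
  have "(\<lambda>t. (p (Suc t) \<bullet> r - p t \<bullet> r) / c) \<longlonglongrightarrow> (l - l) / c"
    using \<open>c > 0\<close> by (intro tendsto_intros l LIMSEQ_Suc[OF l]) auto
  then have "(\<lambda>t. (p (Suc t) \<bullet> r - p t \<bullet> r) / c) \<longlonglongrightarrow> 0" by (simp only: diff_self div_0)
  moreover have "norm ((norm (g t))\<^sup>2) \<le> (p (Suc t) \<bullet> r - p t \<bullet> r) / c" for t
    using ascent[of t] \<open>c > 0\<close> by (simp add: pos_le_divide_eq mult.commute)
  ultimately have "(\<lambda>t. (norm (g t))\<^sup>2) \<longlonglongrightarrow> 0"
    by (rule null_comparison[rotated])
  then have g0: "g \<longlonglongrightarrow> 0"
    by (simp add: tendsto_norm_zero_iff)
  obtain w where w: "\<And>i j. (X *v w) $ i > (X *v w) $ j \<longleftrightarrow> r $ i > r $ j"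
    using assms(6) by blast
  define q where "q i j = ((X *v w) $ i - (X *v w) $ j) * (r $ i - r $ j)" for i j
  have q: "q 1 2 > 0" "q 1 3 > 0" "q 2 3 > 0"
    using w[of 2 1] w[of 3 1] w[of 3 2] r by (simp_all add: q_def)
  have wg: "w \<bullet> g t = p t $ 1 * p t $ 2 * q 1 2 + p t $ 1 * p t $ 3 * q 1 3 + p t $ 2 * p t $ 3 * q 2 3" for t
    unfolding g_def inner_transpose_mult G_def inner_logit_gradient_3 p_def q_def by simp
  have "(\<lambda>t. w \<bullet> g t) \<longlonglongrightarrow> w \<bullet> 0" by (intro tendsto_intros g0)
  then have wg0: "(\<lambda>t. w \<bullet> g t) \<longlonglongrightarrow> 0" by simp
  \<comment> \<open>The pairing with \<open>w\<close> is a sum of three nonnegative terms, so its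
    limit 0 forces each of them to vanish.\<close>
  have pij: "(\<lambda>t. p t $ i * p t $ j) \<longlonglongrightarrow> 0"
    if qij: "q i j > 0" and bound: "\<And>t. p t $ i * p t $ j * q i j \<le> w \<bullet> g t" for i j
  proof (rule null_comparison)
    show "norm (p t $ i * p t $ j) \<le> w \<bullet> g t / q i j" for t
      using bound[of t] qij pos[of t i] pos[of t j] by (simp add: pos_le_divide_eq)
    show "(\<lambda>t. w \<bullet> g t / q i j) \<longlonglongrightarrow> 0"
      using tendsto_divide[OF wg0 tendsto_const, of "q i j"] qij by simp
  qed
  have nn: "p t $ i * p t $ j * x \<ge> 0" if "x > 0" for t i j x
    using pos[of t i] pos[of t j] that by simp
  have p0: "(\<lambda>t. p t $ 1 * p t $ 2) \<longlonglongrightarrow> 0" "(\<lambda>t. p t $ 1 * p t $ 3) \<longlonglongrightarrow> 0"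
      "(\<lambda>t. p t $ 2 * p t $ 3) \<longlonglongrightarrow> 0"
    using nn[OF q(1)] nn[OF q(2)] nn[OF q(3)] by (auto intro!: pij q simp: wg add_nonneg_nonneg)

  \<comment> \<open>All probabilities are positive, so already the initial reward lies strictly
    above \<open>r $ 3\<close>, and \<open>l\<close> is no smaller.\<close>
  have "p 0 \<bullet> r - r $ 3 = p 0 $ 1 * (r $ 1 - r $ 3) + p 0 $ 2 * (r $ 2 - r $ 3)"
    using sum1[of 0] unfolding J by algebra
  also have "\<dots> > 0" using pos r by (intro add_pos_pos mult_pos_pos) auto
  finally have "l \<noteq> r $ 3" using le_l[of 0] by linarith
  moreover have "l \<noteq> r $ 2"
  proof
    assume l2: "l = r $ 2"
    have le: "p t \<bullet> r \<le> r $ 2" for t using le_l l2 by simp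
    define k where "k = (r $ 2 - r $ 3) / (r $ 1 - r $ 2)"
    \<comment> \<open>Multiplying this bound by the first probability reduces its square to a
      product already known to vanish.\<close>
    have "p t $ 1 \<le> p t $ 3 * k" for t
    proof -
      have "p t \<bullet> r - r $ 2 = p t $ 1 * (r $ 1 - r $ 2) - p t $ 3 * (r $ 2 - r $ 3)"
        using sum1[of t] unfolding J by algebra
      then show ?thesis using le[of t] r by (simp add: k_def field_simps)
    qed
    then have "norm ((p t $ 1)\<^sup>2) \<le> p t $ 1 * p t $ 3 * k" for t
      using pos[of t 1] by (simp add: power2_eq_square mult.assoc mult_left_mono)
    moreover have "(\<lambda>t. p t $ 1 * p t $ 3 * k) \<longlonglongrightarrow> 0"
      using tendsto_mult_right[OF p0(2), of k] by simp
    ultimately have "(\<lambda>t. (p t $ 1)\<^sup>2) \<longlonglongrightarrow> 0"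
      by (rule null_comparison)
    then have "(\<lambda>t. p t $ 1) \<longlonglongrightarrow> 0" by simp
    then show False
      using not_middle_reward_limit[of u \<eta> X r Rmax] step assms(7,8) r R le
      unfolding p_def g_def G_def by blast
  qed
  ultimately have l1: "l = r $ 1"
    using reward_limit_3[of "\<lambda>t. X *v u t" r l] p0 l unfolding p_def by blast
  \<comment> \<open>Probability missing from action 1 costs at least \<open>r $ 1 - r $ 2\<close>
    per unit, so the reward gap controls it.\<close>
  have "norm (p t $ 1 - 1) \<le> (r $ 1 - p t \<bullet> r) / (r $ 1 - r $ 2)" for t
  proof -
    have "r $ 1 - p t \<bullet> r = (1 - p t $ 1) * (r $ 1 - r $ 2) + p t $ 3 * (r $ 2 - r $ 3)"
      using sum1[of t] unfolding J by algebra
    moreover have "p t $ 3 * (r $ 2 - r $ 3) \<ge> 0" using pos[of t 3] r by simp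
    moreover have "norm (p t $ 1 - 1) = 1 - p t $ 1"
      using sum1[of t] pos[of t 2] pos[of t 3] by simp
    ultimately show ?thesis using r by (simp add: field_simps)
  qed
  moreover have "(\<lambda>t. (r $ 1 - p t \<bullet> r) / (r $ 1 - r $ 2)) \<longlonglongrightarrow> (r $ 1 - l) / (r $ 1 - r $ 2)"
    using r by (intro tendsto_intros l) auto
  then have "(\<lambda>t. (r $ 1 - p t \<bullet> r) / (r $ 1 - r $ 2)) \<longlonglongrightarrow> 0"
    by (simp add: l1)
  ultimately have "(\<lambda>t. p t $ 1 - 1) \<longlonglongrightarrow> 0"
    by (rule null_comparison)
  then have "(\<lambda>t. softmax (X *v \<theta> (Suc t)) $ 1) \<longlonglongrightarrow> 1"
    unfolding p_def u_def by (rule LIM_zero_cancel)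
  then show ?thesis by (rule LIMSEQ_imp_Suc)
qed

end
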